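(* Let $p\neq q$ be primes, let $k\in\mathbb{Z}$, let $n>m\ge 2$ be integers, and let $f(X)=X^n+qk\,X^m+p^2q$. Then $f$ is non-monogenic.
   Context: A monic irreducible polynomial $f\in\mathbb{Z}[X]$ with root $\theta$ is called monogenic if $\mathbb{Z}[\theta]=\mathcal{O}_K$, where $\mathcal{O}_K$ is the ring of integers of $K=\mathbb{Q}(\theta)$, and non-monogenic if $\mathbb{Z}[\theta]\neq\mathcal{O}_K$. (The polynomial $f$ here is Eisenstein at $q$, hence irreducible over $\mathbb{Q}$.) *)

theory Defs
  imports Complex_Main "HOL-Computational_Algebra.Computational_Algebra"
begin

definition complex_subfield :: "complex set \<Rightarrow> bool" where
  "complex_subfield F \<longleftrightarrow> 1 \<in> F \<and>
     (\<forall>x\<in>F. \<forall>y\<in>F. x - y \<in> F \<and> x * y \<in> F) \<and> (\<forall>x\<in>F. inverse x \<in> F)"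

text \<open>\<open>\<rat>(\<theta>)\<close>: every subfield of the complex numbers contains the rationals, so they need
  not be adjoined explicitly.\<close>

definition rat_adjoin :: "complex \<Rightarrow> complex set" where
  "rat_adjoin \<theta> = \<Inter> {F. complex_subfield F \<and> \<theta> \<in> F}"

definition int_adjoin :: "complex \<Rightarrow> complex set" where
  "int_adjoin \<theta> = range (\<lambda>g :: int poly. poly (map_poly of_int g) \<theta>)"

definition ring_of_integers :: "complex set \<Rightarrow> complex set" where
  "ring_of_integers K = {x \<in> K. algebraic_int x}"

text \<open>The roots of an irreducible polynomial are conjugate, so the choice of the root is immaterial
  for both notions; complex roots exist since a monic irreducible polynomial is not constant.\<close>

definition monogenic :: "int poly \<Rightarrow> bool" where
  "monogenic f \<longleftrightarrow> lead_coeff f = 1 \<and> irreducible f \<and>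
     (\<forall>\<theta>::complex. poly (map_poly of_int f) \<theta> = 0 \<longrightarrow>
        int_adjoin \<theta> = ring_of_integers (rat_adjoin \<theta>))"

definition non_monogenic :: "int poly \<Rightarrow> bool" where
  "non_monogenic f \<longleftrightarrow> lead_coeff f = 1 \<and> irreducible f \<and>
     (\<forall>\<theta>::complex. poly (map_poly of_int f) \<theta> = 0 \<longrightarrow>
        int_adjoin \<theta> \<noteq> ring_of_integers (rat_adjoin \<theta>))"

end

theory Submission
  imports Defs
begin

text \<open>Eisenstein's criterion at \<open>q\<close> gives irreducibility. Let \<open>\<theta>\<close> be a root of \<open>f\<close>. Then
  \<open>\<gamma> = p q / \<theta>\<close> is a root of the monic integer polynomial
  \<open>X\<^sup>n + k p\<^bsup>m-2\<^esup> q\<^sup>m X\<^bsup>n-m\<^esup> + p\<^bsup>n-2\<^esup> q\<^bsup>n-1\<^esup>\<close>, so it is an integer of \<open>\<rat>(\<theta>)\<close>. If \<open>\<gamma> = g(\<theta>)\<close>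
  with \<open>g\<close> integral, then \<open>f\<close> divides \<open>X g - p q\<close> in \<open>\<int>[X]\<close>, and comparing constant terms
  gives the contradiction \<open>p\<^sup>2 q | p q\<close>.\<close>

lemma monic_trinomial:
  fixes b c :: "'a::comm_ring_1"
  assumes "0 < m" "m < n"
  shows degree_monic_trinomial: "degree (monom 1 n + monom b m + [:c:]) = n"
    and lead_coeff_monic_trinomial: "lead_coeff (monom 1 n + monom b m + [:c:]) = 1"
proof -
  let ?f = "monom 1 n + monom b m + [:c:]"
  have top: "coeff ?f n = 1"
    using assms by (simp add: coeff_pCons split: nat.split)
  have "coeff ?f i = 0" if "n < i" for i
    using assms that by (simp add: coeff_pCons split: nat.split)
  then have "degree ?f \<le> n"
    by (intro degree_le) blast
  moreover have "n \<le> degree ?f"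
    by (rule le_degree) (simp only: top, simp)
  ultimately show "degree ?f = n"
    by simp
  with top show "lead_coeff ?f = 1"
    by simp
qed

text \<open>Take the least \<open>i\<close> with \<open>coeff g i\<close> not divisible by
  \<open>q\<close>. In coefficient \<open>i\<close> of \<open>g * h\<close> every term except
  \<open>coeff g i * coeff h 0\<close> carries a factor \<open>q\<close>, so \<open>q\<close>
  divides that term as well, and primality moves it to \<open>coeff h 0\<close>.\<close>

lemma prime_elem_dvd_coeff_mult_0:
  fixes g h :: "'a::idom poly"
  assumes q: "prime_elem q" and n: "degree (g * h) = n" and h: "0 < degree h"
    and "\<not> q dvd lead_coeff (g * h)" and dvd: "\<And>i. i < n \<Longrightarrow> q dvd coeff (g * h) i"
    and "q dvd coeff g 0"
  shows "q dvd coeff h 0"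
proof -
  have nz: "g \<noteq> 0" "h \<noteq> 0"
    using assms(4) by auto
  have lead: "\<not> q dvd coeff g (degree g)"
    using assms(4) by (auto simp: lead_coeff_mult)
  define i where "i = (LEAST i. \<not> q dvd coeff g i)"
  have i: "\<not> q dvd coeff g i"
    unfolding i_def using lead by (rule LeastI)
  have less: "q dvd coeff g j" if "j < i" for j
    using not_less_Least[of j "\<lambda>i. \<not> q dvd coeff g i"] that unfolding i_def by blast
  have "i \<le> degree g"
    unfolding i_def using lead by (rule Least_le)
  \<comment> \<open>Here \<open>0 < degree h\<close> matters: it makes \<open>i\<close> strictly
    smaller than the degree of the product, below which \<open>q\<close> divides all
    coefficients.\<close>
  then have "q dvd coeff (g * h) i"
    using n h nz by (intro dvd) (simp add: degree_mult_eq)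
  moreover have "coeff (g * h) i = (\<Sum>j<i. coeff g j * coeff h (i - j)) + coeff g i * coeff h 0"
    by (simp add: coeff_mult flip: lessThan_Suc_atMost)
  moreover have "q dvd (\<Sum>j<i. coeff g j * coeff h (i - j))"
    using less by (intro dvd_sum) simp
  ultimately have "q dvd coeff g i * coeff h 0"
    by (metis dvd_add_right_iff)
  with q i show ?thesis
    by (simp add: prime_elem_dvd_mult_iff)
qed

theorem eisenstein_criterion:
  fixes f :: "'a::idom_divide poly"
  assumes q: "prime_elem q" and monic: "lead_coeff f = 1" and deg: "0 < degree f"
    and dvd: "\<And>i. i < degree f \<Longrightarrow> q dvd coeff f i" and sq: "\<not> q\<^sup>2 dvd coeff f 0"
  shows "irreducible f"
proof (rule irreducibleI)
  show "f \<noteq> 0"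
    using monic by auto
  show "\<not> is_unit f"
    using deg by (auto simp: is_unit_poly_iff)
next
  fix g h
  assume f: "f = g * h"
  have lead: "\<not> q dvd lead_coeff (g * h)"
    using q monic f by (simp add: prime_elem_not_unit)
  \<comment> \<open>Monicity replaces primitivity: the leading coefficients of the factors multiply
    to 1, so a constant factor is a unit.\<close>
  have unit: "is_unit u" if "degree u = 0" "u * v = f" for u v :: "'a poly"
  proof -
    obtain c where c: "u = [:c:]"
      using \<open>degree u = 0\<close> by (elim degree_eq_zeroE)
    have "c * lead_coeff v = 1"
      using monic that(2) by (simp add: c flip: that(2) split: if_splits)
    then have "1 = u * [:lead_coeff v:]"
      by (simp add: c one_pCons mult.commute)
    then show ?thesis
      by (rule dvdI)
  qed
  show "is_unit g \<or> is_unit h"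
  proof (rule ccontr)
    assume "\<not> (is_unit g \<or> is_unit h)"
    then have pos: "0 < degree g" "0 < degree h"
      using unit[of g h] unit[of h g] f by (auto simp: mult.commute)
    \<comment> \<open>Using the lemma in both orders passes divisibility from either constant term
      to the other. As \<open>q\<close> divides their product, it divides both, whence the
      square.\<close>
    have gh: "q dvd coeff g 0 \<longleftrightarrow> q dvd coeff h 0"
      using prime_elem_dvd_coeff_mult_0[OF q refl, of g h] pos lead dvd f
        prime_elem_dvd_coeff_mult_0[OF q refl, of h g]
      by (auto simp: mult.commute)
    have "q dvd coeff g 0 * coeff h 0"
      using dvd[of 0] deg f by (simp add: coeff_mult)
    then have "q dvd coeff g 0" "q dvd coeff h 0"
      using gh q by (auto simp: prime_elem_dvd_mult_iff)
    then have "q\<^sup>2 dvd coeff f 0"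
      by (simp add: f coeff_mult power2_eq_square mult_dvd_mono)
    with sq show False
      by contradiction
  qed
qed

lemma map_poly_of_int_add:
  "map_poly (of_int :: int \<Rightarrow> 'a::comm_ring_1) (g + h) = map_poly of_int g + map_poly of_int h"
  by (rule poly_eqI) (simp add: coeff_map_poly)

lemma map_poly_of_int_diff:
  "map_poly (of_int :: int \<Rightarrow> 'a::comm_ring_1) (g - h) = map_poly of_int g - map_poly of_int h"
  by (rule poly_eqI) (simp add: coeff_map_poly)

lemma map_poly_of_int_mult:
  "map_poly (of_int :: int \<Rightarrow> 'a::comm_ring_1) (g * h) = map_poly of_int g * map_poly of_int h"
  by (rule poly_eqI) (simp add: coeff_map_poly coeff_mult)

text \<open>Division by an annihilator \<open>d\<close> of least degree is exact only after scaling by a nonzero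
  integer; primality of \<open>f\<close> is what removes these scalars again.\<close>

lemma irreducible_dvd_of_root:
  fixes f g :: "int poly" and x :: "'a::{comm_ring_1,ring_char_0}"
  assumes irr: "irreducible f"
    and f0: "poly (map_poly of_int f) x = 0" and g0: "poly (map_poly of_int g) x = 0"
  shows "f dvd g"
proof -
  define ev where "ev h = poly (map_poly of_int h) x" for h :: "int poly"
  have ev_const: "ev [:c:] = of_int c" for c
    by (simp add: ev_def map_poly_pCons)
  have ev_mult: "ev (a * b) = ev a * ev b" for a b
    by (simp add: ev_def map_poly_of_int_mult)
  have ev_diff: "ev (a - b) = ev a - ev b" for a b
    by (simp add: ev_def map_poly_of_int_diff)
  have prime: "prime_elem f"
    using irr by (rule irreducible_imp_prime_poly)
  have "f \<noteq> 0 \<and> ev f = 0"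
    using irr f0 by (auto simp: ev_def)
  then obtain d where d: "d \<noteq> 0" "ev d = 0"
    and least: "\<And>e. e \<noteq> 0 \<Longrightarrow> ev e = 0 \<Longrightarrow> degree d \<le> degree e"
    using ex_has_least_nat[of "\<lambda>e. e \<noteq> 0 \<and> ev e = 0" f degree] by blast
  \<comment> \<open>A constant evaluates to itself, and in characteristic 0 a nonzero integer stays
    nonzero.\<close>
  have nonconst: "0 < degree h" if "h \<noteq> 0" "ev h = 0" for h
    using that by (auto simp: ev_const intro!: Nat.gr0I elim!: degree_eq_zeroE)
  have scaled: "\<exists>a s. a \<noteq> 0 \<and> [:a:] * h = d * s" if "ev h = 0" for h
  proof -
    obtain a s where as: "a \<noteq> 0" "smult a h = d * s + pseudo_mod h d"
      using pseudo_mod(1)[OF d(1)] by blast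
    have "pseudo_mod h d = [:a:] * h - d * s"
      using as by simp
    then have "ev (pseudo_mod h d) = 0"
      by (simp only: ev_diff ev_mult that d) simp
    \<comment> \<open>Otherwise the pseudo-remainder would be a nonzero annihilator of degree below
      that of \<open>d\<close>.\<close>
    then have "pseudo_mod h d = 0"
      using pseudo_mod(2)[OF d(1), of h] least by fastforce
    with as show ?thesis
      by auto
  qed
  obtain a s where as: "a \<noteq> 0" "[:a:] * f = d * s"
    using scaled \<open>f \<noteq> 0 \<and> ev f = 0\<close> by blast
  have "f dvd d * s"
    by (metis as(2) dvd_triv_right)
  \<comment> \<open>Cancelling \<open>f\<close> would leave \<open>d\<close> as a divisor of the
    nonzero constant \<open>a\<close>, and evaluation at \<open>x\<close> would give
    \<open>a = 0\<close>.\<close>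
  moreover have "\<not> f dvd s"
  proof
    assume "f dvd s"
    then obtain t where t: "s = f * t" ..
    have "f * [:a:] = f * (d * t)"
      using as(2) unfolding t by (simp only: mult_ac)
    then have "[:a:] = d * t"
      using irr by (subst (asm) mult_left_cancel) auto
    then have "of_int a = (0 :: 'a)"
      by (metis ev_const ev_mult d(2) mult_zero_left)
    with as show False
      by simp
  qed
  ultimately have "f dvd d"
    using prime by (simp add: prime_elem_dvd_mult_iff)
  obtain b t where bt: "b \<noteq> 0" "[:b:] * g = d * t"
    using scaled g0 unfolding ev_def by blast
  have "f dvd [:b:] * g"
    unfolding bt using \<open>f dvd d\<close> by (rule dvd_mult2)
  moreover have "\<not> f dvd [:b:]"
    using nonconst[of f] \<open>f \<noteq> 0 \<and> ev f = 0\<close> bt(1) dvd_imp_degree_le[of f "[:b:]"] by auto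
  ultimately show ?thesis
    using prime by (simp only: prime_elem_dvd_mult_iff) blast
qed

lemma of_nat_in_complex_subfield:
  assumes "complex_subfield F"
  shows "of_nat j \<in> F"
proof (induction j)
  case 0
  have "(1::complex) - 1 \<in> F"
    using assms unfolding complex_subfield_def by blast
  then show ?case
    by simp
next
  case (Suc j)
  \<comment> \<open>Closure is given for differences only, so the successor is formed by subtracting
    -1.\<close>
  have "(1::complex) - 1 - 1 \<in> F"
    using assms unfolding complex_subfield_def by blast
  then have "of_nat j - (1 - 1 - 1) \<in> F"
    using assms Suc.IH unfolding complex_subfield_def by blast
  then show ?case
    by (simp add: add.commute)
qed

lemma of_nat_divide_in_rat_adjoin: "of_nat j / \<theta> \<in> rat_adjoin \<theta>"
proof -
  have "of_nat j * inverse \<theta> \<in> F" if "complex_subfield F" "\<theta> \<in> F" for F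
    using that of_nat_in_complex_subfield[OF that(1), of j] unfolding complex_subfield_def by blast
  then show ?thesis
    by (simp add: rat_adjoin_def divide_inverse)
qed

lemma algebraic_int_monic_trinomial:
  fixes x :: "'a::field_char_0"
  assumes "0 < m" "m < n" and root: "x ^ n + of_int b * x ^ m + of_int c = 0"
  shows "algebraic_int x"
proof (rule algebraic_int.intros)
  let ?f = "monom 1 n + monom (of_int b) m + [:of_int c:] :: 'a poly"
  show "lead_coeff ?f = 1"
    using assms by (intro lead_coeff_monic_trinomial)
  show "\<forall>i. coeff ?f i \<in> \<int>"
    by (auto simp: coeff_pCons split: nat.split)
  show "poly ?f x = 0"
    using root by (simp add: poly_monom)
qed

theorem proposition6p3:
  fixes p q n m :: nat and k :: int
  assumes "prime p" and "prime q" and "p \<noteq> q"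
    and "2 \<le> m" and "m < n"
  shows "non_monogenic
           (monom 1 n + monom (int q * k) m + [:(int p)\<^sup>2 * int q:])"
proof -
  let ?f = "monom 1 n + monom (int q * k) m + [:(int p)\<^sup>2 * int q:]"
  have pq: "p > 0" "q > 0"
    using assms by (auto simp: prime_gt_0_nat)
  have monic: "lead_coeff ?f = 1" and deg: "degree ?f = n"
    by (rule lead_coeff_monic_trinomial degree_monic_trinomial, use assms in simp_all)+
  have f_0: "coeff ?f 0 = (int p)\<^sup>2 * int q"
    using assms by simp
  have irr: "irreducible ?f"
  proof (rule eisenstein_criterion[OF _ monic])
    show "prime_elem (int q)"
      using assms by simp
    show "0 < degree ?f"
      using deg assms by simp
    show "int q dvd coeff ?f i" if "i < degree ?f" for i
      using that unfolding deg by (simp add: coeff_pCons split: nat.split)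
    have "\<not> int q dvd (int p)\<^sup>2"
      using assms by (metis prime_dvd_power primes_dvd_imp_eq int_dvd_int_iff prime_nat_int_transfer of_nat_power)
    then show "\<not> (int q)\<^sup>2 dvd coeff ?f 0"
      using pq unfolding f_0 by (simp add: power2_eq_square)
  qed
  have "int_adjoin \<theta> \<noteq> ring_of_integers (rat_adjoin \<theta>)"
    if root: "poly (map_poly of_int ?f) \<theta> = 0" for \<theta> :: complex
  proof
    assume eq: "int_adjoin \<theta> = ring_of_integers (rat_adjoin \<theta>)"
    have \<theta>: "\<theta> ^ n + of_nat q * of_int k * \<theta> ^ m + (of_nat p)\<^sup>2 * of_nat q = 0"
      using root by (simp add: map_poly_of_int_add map_poly_monom map_poly_pCons poly_monom)
    have nz: "\<theta> \<noteq> 0"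
      using \<theta> pq assms by (auto simp: power_0_left)
    define \<gamma> where "\<gamma> = of_nat (p * q) / \<theta>"
    have \<gamma>\<theta>: "\<gamma> * \<theta> = of_nat p * of_nat q"
      using nz by (simp add: \<gamma>_def)
    have "\<gamma> ^ n + of_int (k * int p ^ (m - 2) * int q ^ m) * \<gamma> ^ (n - m)
        + of_int (int p ^ (n - 2) * int q ^ (n - 1)) = 0" (is "?\<Gamma> = 0")
    proof -
      \<comment> \<open>This removes the truncated subtractions: \<open>m - 2\<close> is
        \<open>a\<close> and \<open>n - m\<close> is \<open>Suc b\<close>.\<close>
      obtain a b where mn: "m = a + 2" "n = a + 2 + Suc b"
        using \<open>2 \<le> m\<close> \<open>m < n\<close> by (metis add.commute le_add_diff_inverse less_imp_Suc_add add_Suc_right)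
      \<comment> \<open>Scaling by \<open>\<theta> ^ n\<close> turns powers of \<gamma> into powers
        of \<open>\<gamma> * \<theta>\<close>, that is, of pq. What results is p^(n-2) q^(n-1) times
        the value of \<open>?f\<close> at \<theta>, which is 0.\<close>
      have "?\<Gamma> * \<theta> ^ n = (\<gamma> * \<theta>) ^ n
          + of_int k * of_nat p ^ a * of_nat q ^ m * (\<gamma> * \<theta>) ^ Suc b * \<theta> ^ m
          + of_nat p ^ (n - 2) * of_nat q ^ (n - 1) * \<theta> ^ n"
        by (simp add: mn algebra_simps power_add power_mult_distrib)
      also have "\<dots> = of_nat p ^ (n - 2) * of_nat q ^ (n - 1)
          * (\<theta> ^ n + of_nat q * of_int k * \<theta> ^ m + (of_nat p)\<^sup>2 * of_nat q)"
        unfolding \<gamma>\<theta> by (simp add: mn algebra_simps power_add power_mult_distrib power2_eq_square)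
      finally show ?thesis
        using nz by (simp add: \<theta>)
    qed
    then have "algebraic_int \<gamma>"
      by (rule algebraic_int_monic_trinomial[rotated 2]) (use assms in simp_all)
    then have "\<gamma> \<in> int_adjoin \<theta>"
      unfolding eq ring_of_integers_def \<gamma>_def using of_nat_divide_in_rat_adjoin by blast
    then obtain g :: "int poly" where g: "\<gamma> = poly (map_poly of_int g) \<theta>"
      unfolding int_adjoin_def by blast
    \<comment> \<open>\<open>pCons 0 g\<close> is X g, whose value at \<theta> is
      \<open>\<theta> * \<gamma>\<close>, i.e. pq.\<close>
    have "poly (map_poly of_int (pCons 0 g - [:int p * int q:])) \<theta> = 0"
      using nz by (simp add: map_poly_of_int_diff map_poly_pCons flip: g) (simp add: \<gamma>_def)
    with irr root have "?f dvd pCons 0 g - [:int p * int q:]"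
      by (rule irreducible_dvd_of_root)
    then have "coeff ?f 0 dvd coeff (pCons 0 g - [:int p * int q:]) 0"
      by (metis dvdE dvdI coeff_mult_0)
    \<comment> \<open>The constant term on the right is -pq; cancelling pq from p^2 q leaves
      p.\<close>
    then have "int p dvd 1"
      using pq unfolding f_0 by (simp add: power2_eq_square)
    with \<open>prime p\<close> show False
      by auto
  qed
  with monic irr show ?thesis
    unfolding non_monogenic_def by blast
qed

end
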